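(* The set $\mathbb{R}_+=\{x\in\mathbb{R}\mid x\ge 0\}$ with the multivalued addition $a\mathbin{\nabla} b=\{c\in\mathbb{R}_+\mid |a-b|\le c\le a+b\}$ and the usual multiplication of real numbers is a hyperfield.
   Context: A multivalued binary operation on a set $X$ assigns to each $(a,b)\in X\times X$ a non-empty subset $a\top b\subset X$; it is extended to subsets by $A\top B=\bigcup_{a\in A,b\in B}a\top b$, and one-element sets are identified with their elements. A commutative multigroup is a set $X$ with a multivalued binary operation $\top$ such that: (1) $\top$ is associative, $(a\top b)\top c=a\top(b\top c)$, and commutative, $a\top b=b\top a$; (2) there is $0\in X$ with $0\top a=a$ for all $a$; (3) for each $a\in X$ there is a unique element $-a\in X$ with $0\in a\top(-a)$; (4) $c\in a\top b$ iff $-c\in(-a)\top(-b)$. A multiring is a set $X$ with a multivalued operation $\top$ and a (univalued) multiplication such that $(X,\top)$ is a commutative multigroup, $(X,\cdot)$ is a monoid with unity $1$, $0\cdot a=0$ for all $a$, and $a(b\top c)\subset ab\top ac$, $(b\top c)a\subset ba\top ca$ for all $a,b,c$. A hyperfield is a multiring $X$ such that $X\setminus\{0\}$ is a commutative group under multiplication. *)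

theory Defs
  imports Complex_Main "HOL-Algebra.Group"
begin

text \<open>A multivalued operation is a set-valued binary function; this is its extension to subsets.\<close>

definition mv_ext :: "('a \<Rightarrow> 'a \<Rightarrow> 'a set) \<Rightarrow> 'a set \<Rightarrow> 'a set \<Rightarrow> 'a set"
  where "mv_ext f A B = (\<Union>a\<in>A. \<Union>b\<in>B. f a b)"

text \<open>The description is meaningful only where the opposite element exists uniquely, as
  required by the axiom \<open>ex1_opposite\<close> below.\<close>

definition mv_neg :: "'a set \<Rightarrow> ('a \<Rightarrow> 'a \<Rightarrow> 'a set) \<Rightarrow> 'a \<Rightarrow> 'a \<Rightarrow> 'a"
  where "mv_neg X f z a = (THE b. b \<in> X \<and> z \<in> f a b)"

locale commutative_multigroup =
  fixes X :: "'a set"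
    and f :: "'a \<Rightarrow> 'a \<Rightarrow> 'a set"
    and z :: 'a
  assumes madd_closed: "\<lbrakk>a \<in> X; b \<in> X\<rbrakk> \<Longrightarrow> f a b \<subseteq> X"
    and madd_nonempty: "\<lbrakk>a \<in> X; b \<in> X\<rbrakk> \<Longrightarrow> f a b \<noteq> {}"
    and madd_assoc: "\<lbrakk>a \<in> X; b \<in> X; c \<in> X\<rbrakk> \<Longrightarrow> mv_ext f (f a b) {c} = mv_ext f {a} (f b c)"
    and madd_comm: "\<lbrakk>a \<in> X; b \<in> X\<rbrakk> \<Longrightarrow> f a b = f b a"
    and mzero_closed: "z \<in> X"
    and mzero_left: "a \<in> X \<Longrightarrow> f z a = {a}"
    and ex1_opposite: "a \<in> X \<Longrightarrow> \<exists>!b. b \<in> X \<and> z \<in> f a b"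
    and madd_neg_iff: "\<lbrakk>a \<in> X; b \<in> X; c \<in> X\<rbrakk> \<Longrightarrow>
      c \<in> f a b \<longleftrightarrow> mv_neg X f z c \<in> f (mv_neg X f z a) (mv_neg X f z b)"

record 'a multiring = "'a monoid" +
  madd :: "'a \<Rightarrow> 'a \<Rightarrow> 'a set"  (infixl \<open>\<boxplus>\<index>\<close> 65)
  mzero :: 'a  (\<open>\<zero>\<index>\<close>)

locale multiring = monoid R for R (structure) +
  assumes additive_multigroup: "commutative_multigroup (carrier R) (madd R) \<zero>"
    and mzero_mult: "a \<in> carrier R \<Longrightarrow> \<zero> \<otimes> a = \<zero>"
    and distrib_left: "\<lbrakk>a \<in> carrier R; b \<in> carrier R; c \<in> carrier R\<rbrakk> \<Longrightarrow>
      (\<lambda>x. a \<otimes> x) ` (b \<boxplus> c) \<subseteq> (a \<otimes> b) \<boxplus> (a \<otimes> c)"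
    and distrib_right: "\<lbrakk>a \<in> carrier R; b \<in> carrier R; c \<in> carrier R\<rbrakk> \<Longrightarrow>
      (\<lambda>x. x \<otimes> a) ` (b \<boxplus> c) \<subseteq> (b \<otimes> a) \<boxplus> (c \<otimes> a)"

locale hyperfield = multiring +
  assumes nonzero_comm_group: "comm_group (R\<lparr>carrier := carrier R - {\<zero>}\<rparr>)"

definition triangle_hyperfield :: "real multiring"
  where "triangle_hyperfield =
    \<lparr>carrier = {x. 0 \<le> x}, mult = (\<lambda>a b. a * b), one = 1,
     madd = (\<lambda>a b. {c. 0 \<le> c \<and> \<bar>a - b\<bar> \<le> c \<and> c \<le> a + b}), mzero = 0\<rparr>"

end

theory Submission
  imports Defs
begin

text \<open>An element \<open>c\<close> lies in the sum of \<open>a\<close> and \<open>b\<close> iff \<open>a\<close>, \<open>b\<close>, \<open>c\<close> are the sides of a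
  (possibly degenerate) triangle. Hence \<open>x\<close> lies in the sum of \<open>a\<close>, \<open>b\<close>, \<open>c\<close>, bracketed either
  way, iff \<open>a\<close>, \<open>b\<close>, \<open>c\<close>, \<open>x\<close> are the sides of a quadrilateral, the intermediate sum being the
  length of a diagonal; this condition is symmetric in the four numbers.\<close>

definition triangle_sum :: "real \<Rightarrow> real \<Rightarrow> real set"
  where "triangle_sum a b = {c. 0 \<le> c \<and> \<bar>a - b\<bar> \<le> c \<and> c \<le> a + b}"

text \<open>The bound \<open>\<bar>a - b\<bar> \<le> c\<close> splits into the first two
  inequalities, whose sum yields \<open>0 \<le> c\<close>.\<close>

lemma mem_triangle_sum_iff:
  "c \<in> triangle_sum a b \<longleftrightarrow> a \<le> b + c \<and> b \<le> a + c \<and> c \<le> a + b"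
  by (auto simp: triangle_sum_def)

lemma mem_mv_ext_triangle_sum_iff:
  fixes a b c x :: real
  assumes "0 \<le> a" "0 \<le> b" "0 \<le> c"
  shows "x \<in> mv_ext triangle_sum (triangle_sum a b) {c} \<longleftrightarrow>
    0 \<le> x \<and> a \<le> b + c + x \<and> b \<le> a + c + x \<and> c \<le> a + b + x \<and> x \<le> a + b + c"
    (is "?L \<longleftrightarrow> ?R")
proof
  assume ?L
  then show ?R by (auto simp: mv_ext_def mem_triangle_sum_iff)
next
  assume ?R
  \<comment> \<open>A diagonal must lie in both \<open>[\<bar>a - b\<bar>, a + b]\<close> and
    \<open>[\<bar>c - x\<bar>, c + x]\<close>. The larger lower end works, since \<open>?R\<close>
    and nonnegativity put each lower end below each upper end.\<close>
  then have "max \<bar>a - b\<bar> \<bar>c - x\<bar> \<in> triangle_sum a b"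
    and "x \<in> triangle_sum (max \<bar>a - b\<bar> \<bar>c - x\<bar>) c"
    using assms by (simp_all add: mem_triangle_sum_iff max_def abs_if)
  then show ?L unfolding mv_ext_def by blast
qed

lemma triangle_sum_commute: "triangle_sum a b = triangle_sum b a"
  by (simp add: triangle_sum_def abs_minus_commute add.commute)

lemma triangle_sum_assoc:
  assumes "0 \<le> a" "0 \<le> b" "0 \<le> c"
  shows "mv_ext triangle_sum (triangle_sum a b) {c} = mv_ext triangle_sum {a} (triangle_sum b c)"
proof -
  \<comment> \<open>Moving \<open>a\<close> to the right lets the quadrilateral criterion apply to
    \<open>b\<close>, \<open>c\<close>, \<open>a\<close> as well.\<close>
  have "mv_ext triangle_sum {a} (triangle_sum b c) = mv_ext triangle_sum (triangle_sum b c) {a}"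
    by (simp add: mv_ext_def triangle_sum_commute[of a])
  moreover have "x \<in> mv_ext triangle_sum (triangle_sum a b) {c} \<longleftrightarrow>
      x \<in> mv_ext triangle_sum (triangle_sum b c) {a}" for x
    unfolding mem_mv_ext_triangle_sum_iff[OF assms]
      mem_mv_ext_triangle_sum_iff[OF assms(2,3,1)]
    by (simp only: ac_simps)
  ultimately show ?thesis by blast
qed

text \<open>A triangle with a side \<open>0\<close> has its other two sides equal. Negation being
  the identity, \<open>madd_neg_iff\<close> becomes trivial.\<close>

lemma mv_neg_triangle_sum:
  assumes "0 \<le> a"
  shows "mv_neg {x. 0 \<le> x} triangle_sum 0 a = a"
  unfolding mv_neg_def using assms by (intro the_equality) (auto simp: mem_triangle_sum_iff)

lemma commutative_multigroup_triangle_sum: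
  "commutative_multigroup {x. 0 \<le> x} triangle_sum 0"
proof
  fix a b c :: real
  assume a: "a \<in> {x. 0 \<le> x}"
  show "triangle_sum 0 a = {a}"
    using a by (auto simp: mem_triangle_sum_iff)
  show "\<exists>!b. b \<in> {x. 0 \<le> x} \<and> 0 \<in> triangle_sum a b"
    using a by (intro ex1I[of _ a]) (auto simp: mem_triangle_sum_iff)
  assume b: "b \<in> {x. 0 \<le> x}"
  have "a + b \<in> triangle_sum a b"
    using a b by (simp add: mem_triangle_sum_iff)
  then show "triangle_sum a b \<noteq> {}" by blast
  assume c: "c \<in> {x. 0 \<le> x}"
  show "mv_ext triangle_sum (triangle_sum a b) {c} = mv_ext triangle_sum {a} (triangle_sum b c)"
    using a b c by (simp add: triangle_sum_assoc)
  show "c \<in> triangle_sum a b \<longleftrightarrow> mv_neg {x. 0 \<le> x} triangle_sum 0 c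
      \<in> triangle_sum (mv_neg {x. 0 \<le> x} triangle_sum 0 a) (mv_neg {x. 0 \<le> x} triangle_sum 0 b)"
    using a b c by (simp add: mv_neg_triangle_sum)
qed (auto simp: triangle_sum_def)

text \<open>Scaling by \<open>a \<ge> 0\<close> preserves the triangle inequalities; reversed
  distributivity factors \<open>a\<close> out so that monotonicity applies.\<close>

lemma mult_mem_triangle_sum:
  assumes "0 \<le> a" "x \<in> triangle_sum b c"
  shows "a * x \<in> triangle_sum (a * b) (a * c)" "x * a \<in> triangle_sum (b * a) (c * a)"
  using assms
  by (auto simp: mem_triangle_sum_iff mult_left_mono mult_right_mono
      simp flip: distrib_left distrib_right)

lemma triangle_hyperfield_simps:
  "carrier triangle_hyperfield = {x. 0 \<le> x}"
  "mult triangle_hyperfield = (*)"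
  "one triangle_hyperfield = 1"
  "madd triangle_hyperfield = triangle_sum"
  "mzero triangle_hyperfield = 0"
  by (auto simp: triangle_hyperfield_def triangle_sum_def fun_eq_iff)

theorem theorem5:
  shows "hyperfield triangle_hyperfield"
proof -
  have "monoid triangle_hyperfield"
    by (rule monoidI) (auto simp: triangle_hyperfield_simps)
  moreover have "multiring_axioms triangle_hyperfield"
    by (rule multiring_axioms.intro)
      (auto simp: triangle_hyperfield_simps commutative_multigroup_triangle_sum
        mult_mem_triangle_sum)
  moreover have "comm_group (triangle_hyperfield\<lparr>carrier :=
      carrier triangle_hyperfield - {mzero triangle_hyperfield}\<rparr>)"
  proof (rule comm_groupI, goal_cases)
    \<comment> \<open>This goal asks for a left inverse; the reciprocal of a positive real is
      positive.\<close>
    case (6 x)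
    then show ?case
      by (intro bexI[of _ "inverse x"]) (auto simp: triangle_hyperfield_simps)
  qed (auto simp: triangle_hyperfield_simps)
  ultimately show ?thesis
    by (intro hyperfield.intro multiring.intro hyperfield_axioms.intro)
qed

end
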